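(* Let $n\geq 2$, $k>0$ and $\lambda\geq 0$. If there exists a family $\{\Omega(t)\}_{t\in\mathbb{R}^+}$ of compact $\lambda$-convex domains in the complex hyperbolic space $\mathbb{C}H^n(-4k^2)$ expanding over the whole space $\mathbb{C}H^n(-4k^2)$, then $\lambda\leq k$.
   Context: $\mathbb{C}H^n(-4k^2)$ denotes complex hyperbolic space of complex dimension $n$ (real dimension $2n$): the unique (up to holomorphic isometry) complete simply connected Kähler manifold of constant holomorphic sectional curvature $-4k^2$. It is a Hadamard manifold (complete, simply connected, nonpositive sectional curvature) with sectional curvatures in $[-4k^2,-k^2]$. $\lambda$-convexity ($\lambda\ge 0$): A $\mathcal{C}^2$ hypersurface of a Riemannian manifold is regular $\lambda$-convex if at every point all its normal curvatures with respect to the inward unit normal $N$ (that is, $\langle -\nabla_v N,v\rangle$ for unit tangent vectors $v$; geodesic spheres in a Hadamard manifold have positive normal curvatures) are greater than or equal to $\lambda$. A (not necessarily regular) hypersurface is $\lambda$-convex if for every point $p$ of it there is a regular $\lambda$-convex hypersurface $S$ through $p$ such that a neighborhood of $p$ in the hypersurface lies on the convex side of $S$ (the side into which the inward normal of $S$ points). A domain is (regular) $\lambda$-convex if its boundary is a (regular) $\lambda$-convex hypersurface. A family $\{\Omega(t)\}_{t\in\mathbb{R}^+}$ of compact domains expands over the whole space if every compact subset of the space is contained in $\Omega(t)$ for all sufficiently large $t$. *)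

theory Defs
  imports "HOL-Analysis.Analysis"
begin

section \<open>Riemannian metrics on an open subset of a Euclidean space\<close>

text \<open>A Riemannian metric on an open set \<open>M\<close> of a Euclidean space is a function \<open>g\<close> such that
  \<open>g x\<close> is the inner product on the tangent space at \<open>x \<in> M\<close>, which is identified with the
  ambient vector space.\<close>

type_synonym 'a metric_field = "'a \<Rightarrow> 'a \<Rightarrow> 'a \<Rightarrow> real"

text \<open>Christoffel operator of the Levi-Civita connection, i.e. the covariant derivative in direction
  \<open>u\<close> of the constant vector field \<open>v\<close>, given by the Koszul formula
  \<open>2 g(\<nabla>\<^sub>u v, w) = u(g(v,w)) + v(g(u,w)) - w(g(u,v))\<close> for constant fields.\<close>

definition christoffel ::
    "('a::euclidean_space) metric_field \<Rightarrow> 'a \<Rightarrow> 'a \<Rightarrow> 'a \<Rightarrow> 'a" where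
  "christoffel g x u v = (THE c. \<forall>w. 2 * g x c w =
      frechet_derivative (\<lambda>y. g y v w) (at x) u
    + frechet_derivative (\<lambda>y. g y u w) (at x) v
    - frechet_derivative (\<lambda>y. g y u v) (at x) w)"

definition cov_deriv ::
    "('a::euclidean_space) metric_field \<Rightarrow> ('a \<Rightarrow> 'a) \<Rightarrow> 'a \<Rightarrow> 'a \<Rightarrow> 'a" where
  "cov_deriv g X x v = frechet_derivative X (at x) v + christoffel g x v (X x)"

definition riemann_gradient ::
    "('a::euclidean_space) metric_field \<Rightarrow> ('a \<Rightarrow> real) \<Rightarrow> 'a \<Rightarrow> 'a" where
  "riemann_gradient g f x = (THE w. \<forall>v. g x w v = frechet_derivative f (at x) v)"

definition unit_gradient ::
    "('a::euclidean_space) metric_field \<Rightarrow> ('a \<Rightarrow> real) \<Rightarrow> 'a \<Rightarrow> 'a" where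
  "unit_gradient g f x =
     (let w = riemann_gradient g f x in (1 / sqrt (g x w w)) *\<^sub>R w)"

text \<open>\<open>riemann_curvature g x u v w = R(u,v)w\<close>, with the convention
  \<open>R(u,v) = [\<nabla>\<^sub>u, \<nabla>\<^sub>v] - \<nabla>\<^bsub>[u,v]\<^esub>\<close> (so that the sectional curvature of the plane spanned by
  orthonormal \<open>u\<close>, \<open>v\<close> is \<open>g(R(u,v)v,u)\<close>), evaluated on constant vector fields.\<close>

definition riemann_curvature ::
    "('a::euclidean_space) metric_field \<Rightarrow> 'a \<Rightarrow> 'a \<Rightarrow> 'a \<Rightarrow> 'a \<Rightarrow> 'a" where
  "riemann_curvature g x u v w =
     cov_deriv g (\<lambda>y. christoffel g y v w) x u - cov_deriv g (\<lambda>y. christoffel g y u w) x v"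


section \<open>Hypersurfaces and convexity\<close>

definition C2_on :: "('a::euclidean_space) set \<Rightarrow> ('a \<Rightarrow> real) \<Rightarrow> bool" where
  "C2_on U f \<longleftrightarrow> (\<exists>(f' :: 'a \<Rightarrow> 'a \<Rightarrow>\<^sub>L real) (f'' :: 'a \<Rightarrow> 'a \<Rightarrow>\<^sub>L 'a \<Rightarrow>\<^sub>L real).
     (\<forall>x\<in>U. (f has_derivative blinfun_apply (f' x)) (at x)) \<and>
     (\<forall>x\<in>U. (f' has_derivative blinfun_apply (f'' x)) (at x)) \<and>
     continuous_on U f'')"

text \<open>\<open>defining_function g M S N U f\<close>: on the open set \<open>U\<close> the hypersurface \<open>S\<close> is the regular zero
  set of the \<open>C\<^sup>2\<close> function \<open>f\<close>, and the unit normal field \<open>N\<close> of \<open>S\<close> points into \<open>{f > 0}\<close>.\<close>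

definition defining_function ::
    "('a::euclidean_space) metric_field \<Rightarrow> 'a set \<Rightarrow> 'a set \<Rightarrow> ('a \<Rightarrow> 'a) \<Rightarrow> 'a set \<Rightarrow> ('a \<Rightarrow> real) \<Rightarrow> bool"
  where
  "defining_function g M S N U f \<longleftrightarrow>
     open U \<and> U \<subseteq> M \<and> C2_on U f \<and> S \<inter> U = {x\<in>U. f x = 0} \<and>
     (\<forall>x\<in>S \<inter> U. frechet_derivative f (at x) \<noteq> (\<lambda>v. 0) \<and> N x = unit_gradient g f x)"

text \<open>A \<open>C\<^sup>2\<close> hypersurface \<open>S\<close> of \<open>M\<close>, co-oriented by the (inward) unit normal field \<open>N\<close>.  Only the
  values of \<open>N\<close> on \<open>S\<close> matter.\<close>

definition regular_hypersurface ::
    "('a::euclidean_space) metric_field \<Rightarrow> 'a set \<Rightarrow> 'a set \<Rightarrow> ('a \<Rightarrow> 'a) \<Rightarrow> bool" where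
  "regular_hypersurface g M S N \<longleftrightarrow>
     S \<subseteq> M \<and> (\<forall>p\<in>S. \<exists>U f. p \<in> U \<and> defining_function g M S N U f)"

text \<open>To differentiate \<open>N\<close> we use the local \<open>C\<^sup>1\<close> extension \<open>unit_gradient g f\<close>; for \<open>v\<close> tangent to
  \<open>S\<close> the value \<open>\<nabla>\<^sub>v N\<close> does not depend on the choice of \<open>f\<close>.\<close>

definition regular_lambda_convex ::
    "('a::euclidean_space) metric_field \<Rightarrow> 'a set \<Rightarrow> real \<Rightarrow> 'a set \<Rightarrow> ('a \<Rightarrow> 'a) \<Rightarrow> bool" where
  "regular_lambda_convex g M lam S N \<longleftrightarrow>
     regular_hypersurface g M S N \<and>
     (\<forall>p\<in>S. \<forall>U f v. p \<in> U \<and> defining_function g M S N U f \<and>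
        g p (N p) v = 0 \<and> g p v v = 1 \<longrightarrow>
          g p (- cov_deriv g (unit_gradient g f) p v) v \<ge> lam)"

definition locally_on_convex_side ::
    "('a::euclidean_space) metric_field \<Rightarrow> 'a set \<Rightarrow> 'a set \<Rightarrow> ('a \<Rightarrow> 'a) \<Rightarrow> 'a set \<Rightarrow> 'a \<Rightarrow> bool" where
  "locally_on_convex_side g M S N H p \<longleftrightarrow>
     (\<exists>U f. p \<in> U \<and> defining_function g M S N U f \<and> (\<forall>x\<in>H \<inter> U. f x \<ge> 0))"

text \<open>A topological manifold of codimension one: locally homeomorphic to a hyperplane.\<close>

definition topological_hypersurface :: "('a::euclidean_space) set \<Rightarrow> bool" where
  "topological_hypersurface H \<longleftrightarrow>
     (\<forall>p\<in>H. \<exists>U (b::'a). p \<in> U \<and> open U \<and> b \<noteq> 0 \<and> (H \<inter> U) homeomorphic {x. b \<bullet> x = 0})"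

text \<open>A hypersurface \<open>H\<close>, with a side singled out as the inner one, is \<open>\<lambda>\<close>-convex if it is supported at
  each of its points by a regular \<open>\<lambda>\<close>-convex hypersurface.  The relation \<open>inward p n\<close> expresses
  that \<open>n\<close> points to the inner side of \<open>H\<close> at \<open>p\<close>.\<close>

definition lambda_convex_hypersurface ::
    "('a::euclidean_space) metric_field \<Rightarrow> 'a set \<Rightarrow> real \<Rightarrow> ('a \<Rightarrow> 'a \<Rightarrow> bool) \<Rightarrow> 'a set \<Rightarrow> bool" where
  "lambda_convex_hypersurface g M lam inward H \<longleftrightarrow>
     topological_hypersurface H \<and> H \<subseteq> M \<and>
     (\<forall>p\<in>H. \<exists>S N. p \<in> S \<and> regular_lambda_convex g M lam S N \<and> inward p (N p) \<and>
        locally_on_convex_side g M S N H p)"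

text \<open>At a corner of \<open>\<Omega>\<close> the inward normal of a supporting hypersurface need not point into \<open>\<Omega>\<close>
  itself, but its opposite always leaves \<open>\<Omega>\<close>.\<close>

definition inward_at :: "('a::euclidean_space) set \<Rightarrow> 'a \<Rightarrow> 'a \<Rightarrow> bool" where
  "inward_at \<Omega> p n \<longleftrightarrow> (\<forall>\<^sub>F s in at_right 0. p - s *\<^sub>R n \<notin> \<Omega>)"

definition lambda_convex_domain ::
    "('a::euclidean_space) metric_field \<Rightarrow> 'a set \<Rightarrow> real \<Rightarrow> 'a set \<Rightarrow> bool" where
  "lambda_convex_domain g M lam \<Omega> \<longleftrightarrow>
     lambda_convex_hypersurface g M lam (inward_at \<Omega>) (frontier \<Omega>)"

definition compact_domain :: "('a::euclidean_space) set \<Rightarrow> 'a set \<Rightarrow> bool" where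
  "compact_domain M \<Omega> \<longleftrightarrow> compact \<Omega> \<and> \<Omega> \<subseteq> M \<and>
     (\<exists>D. open D \<and> connected D \<and> D \<noteq> {} \<and> \<Omega> = closure D)"

definition expands_over :: "('a::euclidean_space) set \<Rightarrow> (real \<Rightarrow> 'a set) \<Rightarrow> bool" where
  "expands_over M \<Omega> \<longleftrightarrow> (\<forall>K. compact K \<and> K \<subseteq> M \<longrightarrow> (\<forall>\<^sub>F t in at_top. K \<subseteq> \<Omega> t))"


section \<open>Complex hyperbolic space\<close>

text \<open>The ball model: the open unit ball of \<open>\<complex>\<^sup>n\<close> with the Bergman metric
  \<open>k\<^sup>-\<^sup>2 (|u|\<^sup>2 / (1 - |z|\<^sup>2) + |\<langle>u,z\<rangle>|\<^sup>2 / (1 - |z|\<^sup>2)\<^sup>2)\<close>.  The factor \<open>k\<^sup>-\<^sup>2\<close> makes the holomorphic sectional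
  curvature equal to \<open>-4k\<^sup>2\<close>, see \<open>holomorphic_sectional_curvature_CH\<close> below.  The topology of the metric is the
  Euclidean one.\<close>

definition herm :: "complex ^ 'n \<Rightarrow> complex ^ 'n \<Rightarrow> complex" where
  "herm u v = (\<Sum>i\<in>UNIV. u $ i * cnj (v $ i))"

definition CH_space :: "(complex ^ 'n) set" where
  "CH_space = ball 0 1"

definition CH_metric :: "real \<Rightarrow> (complex ^ 'n) metric_field" where
  "CH_metric k z u v =
     (Re (herm u v) / (1 - (norm z)\<^sup>2) + Re (herm u z * herm z v) / (1 - (norm z)\<^sup>2)\<^sup>2) / k\<^sup>2"

lemma herm_add_left: "herm (u + v) w = herm u w + herm v w"
  and herm_add_right: "herm w (u + v) = herm w u + herm w v"
  and herm_diff_left: "herm (u - v) w = herm u w - herm v w"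
  and herm_smult_left: "herm (c *s u) w = c * herm u w"
  and herm_smult_right: "herm w (c *s u) = cnj c * herm w u"
  and herm_scaleR_left: "herm (r *\<^sub>R u) w = of_real r * herm u w"
  and herm_scaleR_right: "herm w (r *\<^sub>R u) = of_real r * herm w u"
  by (simp_all add: herm_def sum.distrib sum_distrib_left sum_subtractf algebra_simps scaleR_conv_of_real[where 'a = complex])

lemma herm_commute: "herm v u = cnj (herm u v)"
  by (simp add: herm_def mult.commute)

lemma inner_eq_Re_herm: "u \<bullet> v = Re (herm u v)"
  by (simp add: herm_def inner_vec_def inner_complex_def)

lemma herm_self: "herm u u = of_real ((norm u)\<^sup>2)"
proof (rule complex_eqI)
  show "Re (herm u u) = Re (of_real ((norm u)\<^sup>2))"
    by (simp add: inner_eq_Re_herm[symmetric] power2_norm_eq_inner)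
  have "Im (herm u u) = - Im (herm u u)" using herm_commute[of u u] by (metis cnj.simps(2))
  then show "Im (herm u u) = Im (of_real ((norm u)\<^sup>2))" by simp
qed

lemma bounded_bilinear_herm: "bounded_bilinear (herm :: complex^'n \<Rightarrow> complex^'n \<Rightarrow> complex)"
proof (rule bilinear_conv_bounded_bilinear[THEN iffD1])
  show "bilinear (herm :: complex^'n \<Rightarrow> complex^'n \<Rightarrow> complex)"
    unfolding bilinear_def
    by (auto intro!: linearI simp: herm_add_left herm_add_right herm_scaleR_left herm_scaleR_right scaleR_conv_of_real[where 'a = complex])
qed

lemma CH_metric_sym: "CH_metric k z u v = CH_metric k z v u"
proof -
  have "Re (herm u z * herm z v) = Re (herm v z * herm z u)"
    using herm_commute[of u z] herm_commute[of z v] by simp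
  moreover have "Re (herm u v) = Re (herm v u)" using herm_commute[of u v] by simp
  ultimately show ?thesis by (simp add: CH_metric_def)
qed

lemma CH_metric_diff_left: "CH_metric k z (u - v) w = CH_metric k z u w - CH_metric k z v w"
  by (simp add: CH_metric_def herm_diff_left algebra_simps diff_divide_distrib add_divide_distrib)

lemma CH_metric_self:
  "CH_metric k z u u = ((norm u)\<^sup>2 / (1 - (norm z)\<^sup>2) + (cmod (herm u z))\<^sup>2 / (1 - (norm z)\<^sup>2)\<^sup>2) / k\<^sup>2"
proof -
  have "herm u z * herm z u = of_real ((cmod (herm u z))\<^sup>2)"
    using herm_commute[of z u] by (metis complex_norm_square)
  then show ?thesis by (simp add: CH_metric_def herm_self)
qed

lemma CH_metric_pos:
  assumes "k > 0" "z \<in> CH_space" "u \<noteq> 0"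
  shows "CH_metric k z u u > 0"
proof -
  have "1 - (norm z)\<^sup>2 > 0" using assms(2) by (simp add: CH_space_def power_less_one_iff abs_square_less_1)
  then show ?thesis using assms unfolding CH_metric_self
    by (intro divide_pos_pos add_pos_nonneg) auto
qed

lemma CH_metric_eqI:
  assumes "k > 0" "z \<in> CH_space" "\<And>w. CH_metric k z a w = CH_metric k z b w"
  shows "a = b"
proof (rule ccontr)
  assume "a \<noteq> b"
  then have "CH_metric k z (a - b) (a - b) > 0" using CH_metric_pos[OF assms(1,2), of "a - b"] by simp
  then show False using assms(3)[of "a - b"] by (simp add: CH_metric_diff_left)
qed

lemma has_derivative_CH_metric:
  fixes z :: "complex ^ 'n"
  assumes z: "z \<in> CH_space"
  shows "((\<lambda>y. CH_metric k y b c) has_derivative (\<lambda>a.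
     (Re (herm b c) * (2 * Re (herm z a)) / (1 - (norm z)\<^sup>2)\<^sup>2
      + Re (herm b a * herm z c + herm b z * herm a c) / (1 - (norm z)\<^sup>2)\<^sup>2
      + Re (herm b z * herm z c) * (4 * Re (herm z a)) / (1 - (norm z)\<^sup>2)^3) / k\<^sup>2)) (at z)"
proof -
  have s: "1 - (norm z)\<^sup>2 > 0" using z by (simp add: CH_space_def abs_square_less_1)
  have n: "((\<lambda>y::complex^'n. 1 - (norm y)\<^sup>2) has_derivative (\<lambda>a. - (2 * Re (herm z a)))) (at z)"
    unfolding power2_norm_eq_inner
    by (auto intro!: derivative_eq_intros simp: inner_eq_Re_herm[symmetric] inner_commute)
  have i1: "((\<lambda>y. Re (herm b c) / (1 - (norm y)\<^sup>2)) has_derivative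
      (\<lambda>a. Re (herm b c) * (2 * Re (herm z a)) / (1 - (norm z)\<^sup>2)\<^sup>2)) (at z)"
    by (rule has_derivative_eq_rhs[OF has_derivative_divide[OF has_derivative_const n]])
       (use s in \<open>auto simp: fun_eq_iff divide_simps power2_eq_square\<close>)
  have h: "((\<lambda>y. Re (herm b y * herm y c)) has_derivative
      (\<lambda>a. Re (herm b a * herm z c + herm b z * herm a c))) (at z)"
  proof -
    have h1: "((\<lambda>y. herm b y) has_derivative (\<lambda>a. herm b a)) (at z)"
      by (rule bounded_linear_imp_has_derivative[OF bounded_bilinear.bounded_linear_right[OF bounded_bilinear_herm]])
    have h2: "((\<lambda>y. herm y c) has_derivative (\<lambda>a. herm a c)) (at z)"
      by (rule bounded_linear_imp_has_derivative[OF bounded_bilinear.bounded_linear_left[OF bounded_bilinear_herm]])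
    show ?thesis
      by (rule has_derivative_eq_rhs[OF bounded_linear.has_derivative[OF bounded_linear_Re has_derivative_mult[OF h1 h2]]])
         (simp add: algebra_simps)
  qed
  have i2: "((\<lambda>y. Re (herm b y * herm y c) / (1 - (norm y)\<^sup>2)\<^sup>2) has_derivative
      (\<lambda>a. Re (herm b a * herm z c + herm b z * herm a c) / (1 - (norm z)\<^sup>2)\<^sup>2
         + Re (herm b z * herm z c) * (4 * Re (herm z a)) / (1 - (norm z)\<^sup>2)^3)) (at z)"
  proof -
    have i0: "((\<lambda>y::complex^'n. 1 / (1 - (norm y)\<^sup>2)) has_derivative
        (\<lambda>a. 2 * Re (herm z a) / (1 - (norm z)\<^sup>2)\<^sup>2)) (at z)"
      by (rule has_derivative_eq_rhs[OF has_derivative_divide[OF has_derivative_const n]])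
         (use s in \<open>auto simp: fun_eq_iff divide_simps power2_eq_square\<close>)
    have "((\<lambda>y. Re (herm b y * herm y c) * (1 / (1 - (norm y)\<^sup>2))\<^sup>2) has_derivative
      (\<lambda>a. Re (herm b a * herm z c + herm b z * herm a c) / (1 - (norm z)\<^sup>2)\<^sup>2
         + Re (herm b z * herm z c) * (4 * Re (herm z a)) / (1 - (norm z)\<^sup>2)^3)) (at z)"
      by (rule has_derivative_eq_rhs[OF has_derivative_mult[OF h has_derivative_power[OF i0, of 2]]])
         (simp add: fun_eq_iff power2_eq_square power3_eq_cube)
    then show ?thesis by (simp add: power_divide)
  qed
  show ?thesis unfolding CH_metric_def
    by (rule has_derivative_eq_rhs[OF bounded_linear.has_derivative[OF bounded_linear_divide has_derivative_add[OF i1 i2]]])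
       (simp add: algebra_simps)
qed

lemma christoffel_CH:
  fixes z :: "complex ^ 'n"
  assumes k: "k > 0" and z: "z \<in> CH_space"
  shows "christoffel (CH_metric k) z u v =
    (1 / (1 - (norm z)\<^sup>2)) *\<^sub>R (herm u z *s v + herm v z *s u)"
proof -
  have fd: "frechet_derivative (\<lambda>y. CH_metric k y b c) (at z) a =
     (Re (herm b c) * (2 * Re (herm z a)) / (1 - (norm z)\<^sup>2)\<^sup>2
      + Re (herm b a * herm z c + herm b z * herm a c) / (1 - (norm z)\<^sup>2)\<^sup>2
      + Re (herm b z * herm z c) * (4 * Re (herm z a)) / (1 - (norm z)\<^sup>2)^3) / k\<^sup>2" for a b c
    using fun_cong[OF frechet_derivative_at[OF has_derivative_CH_metric[OF z, of k b c]], of a] by simp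
  let ?c = "(1 / (1 - (norm z)\<^sup>2)) *\<^sub>R (herm u z *s v + herm v z *s u)"
  let ?K = "\<lambda>w. frechet_derivative (\<lambda>y. CH_metric k y v w) (at z) u
    + frechet_derivative (\<lambda>y. CH_metric k y u w) (at z) v
    - frechet_derivative (\<lambda>y. CH_metric k y u v) (at z) w"
  have eq: "2 * CH_metric k z ?c w = ?K w" for w
  proof -
    define s where "s = 1 - (norm z)\<^sup>2"
    have c: "herm z w = cnj (herm w z)" "herm z u = cnj (herm u z)" "herm z v = cnj (herm v z)"
       "herm v u = cnj (herm u v)" "herm w u = cnj (herm u w)" "herm w v = cnj (herm v w)"
      using herm_commute by auto
    define t where "t = 1 / s"
    have t: "x / s = x * t" "x / s\<^sup>2 = x * t^2" "x / s^3 = x * t^3" for x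
      by (simp_all add: t_def power_divide)
    show ?thesis
      unfolding fd
      unfolding CH_metric_def herm_scaleR_left herm_add_left herm_smult_left c s_def[symmetric] t
        add_divide_distrib[symmetric] diff_divide_distrib[symmetric] times_divide_eq_right
      by (rule arg_cong[where f = "\<lambda>x. x / k\<^sup>2"])
         (simp add: algebra_simps power2_eq_square power3_eq_cube)
  qed
  show ?thesis unfolding christoffel_def
  proof (rule the_equality)
    show "\<forall>w. 2 * CH_metric k z ?c w = ?K w" using eq by blast
  next
    fix c assume "\<forall>w. 2 * CH_metric k z c w = ?K w"
    then have "2 * CH_metric k z c w = 2 * CH_metric k z ?c w" for w using eq by metis
    then show "c = ?c" by (intro CH_metric_eqI[OF k z]) simp
  qed
qed

lemma CH_isotropic_curvature:
  fixes z :: "complex ^ 'n"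
  assumes k: "k > 0" and z: "z \<in> CH_space"
  shows "riemann_curvature (CH_metric k) z u (\<i> *s u) (\<i> *s u)
    = - (4 * k\<^sup>2 * CH_metric k z u u) *\<^sub>R u"
proof -
  define s where "s = 1 - (norm z)\<^sup>2"
  have s0: "s > 0" using z by (simp add: s_def CH_space_def abs_square_less_1)
  have op: "open (CH_space :: (complex^'n) set)" by (simp add: CH_space_def)
  have fd: "frechet_derivative (\<lambda>y. christoffel (CH_metric k) y v w) (at z) a =
      (1 / s) *\<^sub>R (herm v a *s w + herm w a *s v)
      + (2 * Re (herm z a) / s\<^sup>2) *\<^sub>R (herm v z *s w + herm w z *s v)" for v w a
  proof -
    have n: "((\<lambda>y::complex^'n. 1 - (norm y)\<^sup>2) has_derivative (\<lambda>a. - (2 * Re (herm z a)))) (at z)"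
      unfolding power2_norm_eq_inner
      by (auto intro!: derivative_eq_intros simp: inner_eq_Re_herm[symmetric] inner_commute)
    have i: "((\<lambda>y::complex^'n. 1 / (1 - (norm y)\<^sup>2)) has_derivative (\<lambda>a. 2 * Re (herm z a) / s\<^sup>2)) (at z)"
      by (rule has_derivative_eq_rhs[OF has_derivative_divide[OF has_derivative_const n]])
         (use s0 in \<open>auto simp: s_def fun_eq_iff divide_simps power2_eq_square\<close>)
    have bl: "bounded_linear (\<lambda>y. herm v y *s w + herm w y *s v)"
      unfolding linear_conv_bounded_linear[symmetric]
      by (auto intro!: linearI simp: herm_add_right herm_scaleR_right vec_eq_iff algebra_simps
            scaleR_conv_of_real[where 'a = complex])
    have "((\<lambda>y. (1 / (1 - (norm y)\<^sup>2)) *\<^sub>R (herm v y *s w + herm w y *s v)) has_derivative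
       (\<lambda>a. (1 / s) *\<^sub>R (herm v a *s w + herm w a *s v)
      + (2 * Re (herm z a) / s\<^sup>2) *\<^sub>R (herm v z *s w + herm w z *s v))) (at z)"
      using has_derivative_scaleR[OF i bounded_linear_imp_has_derivative[OF bl]]
      by (simp add: s_def)
    then have "((\<lambda>y. christoffel (CH_metric k) y v w) has_derivative
       (\<lambda>a. (1 / s) *\<^sub>R (herm v a *s w + herm w a *s v)
      + (2 * Re (herm z a) / s\<^sup>2) *\<^sub>R (herm v z *s w + herm w z *s v))) (at z)"
      by (rule has_derivative_transform_within_open[OF _ op z]) (simp add: christoffel_CH[OF k])
    from fun_cong[OF frechet_derivative_at[OF this], of a] show ?thesis by simp
  qed
  define t where "t = 1 / s"
  have t: "1 / s = t" "x / s = x * t" "x / s\<^sup>2 = x * t^2" for x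
    by (simp_all add: t_def power_divide)
  have g: "4 * k\<^sup>2 * CH_metric k z u u = 4 * (Re (herm u u) / s + Re (herm u z * herm z u) / s\<^sup>2)"
    using k by (simp add: CH_metric_def s_def)
  have c: "herm z u = cnj (herm u z)" by (rule herm_commute)
  have r: "Im (herm u u) = 0" by (simp add: herm_self)
  show ?thesis
    unfolding riemann_curvature_def cov_deriv_def fd christoffel_CH[OF k z] g
      herm_scaleR_left herm_add_left herm_smult_left herm_smult_right c s_def[symmetric] t
    by (simp add: vec_eq_iff complex_eq_iff r) (simp add: algebra_simps power2_eq_square)
qed

lemma holomorphic_sectional_curvature_CH:
  assumes "k > 0" "z \<in> CH_space" "CH_metric k z u u = 1"
  shows "CH_metric k z (riemann_curvature (CH_metric k) z u (\<i> *s u) (\<i> *s u)) u = - 4 * k\<^sup>2"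
proof -
  have "CH_metric k z (r *\<^sub>R u) u = r * CH_metric k z u u" for r
    by (simp add: CH_metric_def herm_scaleR_left algebra_simps add_divide_distrib diff_divide_distrib)
  then show ?thesis
    unfolding CH_isotropic_curvature[OF assms(1,2)] using assms(3) by (simp del: scaleR_minus_left)
qed

end

theory Submission
  imports Defs
begin

text \<open>Let \<open>p\<close> be a point of \<open>\<partial>\<Omega>\<close> closest to the centre of the ball model.  The geodesic ball through
  \<open>p\<close> around the centre lies in \<open>\<Omega>\<close>, hence on the convex side of the hypersurface \<open>S\<close> supporting
  \<open>\<Omega>\<close> at \<open>p\<close>, so the normal curvatures of \<open>S\<close> at \<open>p\<close> are at most those of the geodesic sphere.  In a
  direction \<open>v\<close> that is complex orthogonal to \<open>p\<close> (one exists since \<open>n \<ge> 2\<close>) the latter is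
  \<open>k / |p|\<close>, which is \<open>k coth(k r)\<close> for the geodesic radius \<open>r\<close>.  When \<open>\<Omega>(t)\<close> exhausts the space,
  \<open>|p|\<close> tends to \<open>1\<close>.\<close>

section \<open>Calculus: local minima on the line and Euclidean gradients\<close>

text \<open>If \<open>d\<close> were negative, \<open>h'\<close>, which vanishes at
  \<open>x\<close>, would be negative just to the right of \<open>x\<close>, and the mean value
  theorem would take \<open>h\<close> below its local minimum.\<close>

lemma second_derivative_nonneg_at_local_min:
  fixes h h' :: "real \<Rightarrow> real"
  assumes h: "\<forall>\<^sub>F t in nhds x. (h has_real_derivative h' t) (at t)"
    and h': "(h' has_real_derivative d) (at x)"
    and min: "\<forall>\<^sub>F t in nhds x. h x \<le> h t"
  shows "h' x = 0" and "d \<ge> 0"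
proof -
  obtain e where e: "e > 0"
    "\<And>t. dist t x < e \<Longrightarrow> (h has_real_derivative h' t) (at t) \<and> h x \<le> h t"
    using eventually_conj[OF h min] unfolding eventually_nhds_metric by blast
  show 0: "h' x = 0"
    by (rule DERIV_local_min[of h _ x e]) (use e in \<open>auto simp: dist_real_def abs_minus_commute\<close>)
  show "d \<ge> 0"
  proof (rule ccontr)
    assume "\<not> d \<ge> 0"
    then obtain r where r: "r > 0" "\<And>s. 0 < s \<Longrightarrow> s < r \<Longrightarrow> h' (x + s) < h' x"
      using has_real_derivative_neg_dec_right[OF h'] by auto
    define s where "s = min e r / 2"
    have s: "0 < s" "s < e" "s < r" using e(1) r(1) by (auto simp: s_def min_def)
    have "\<exists>z. x < z \<and> z < x + s \<and> h (x + s) - h x = (x + s - x) * h' z"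
      by (rule MVT2) (use e s in \<open>auto simp: dist_real_def\<close>)
    then obtain z where z: "x < z" "z < x + s" "h (x + s) - h x = s * h' z" by auto
    have "h' z < 0" using r(2)[of "z - x"] z s 0 by auto
    then have "h (x + s) < h x" using z(3) s(1) by (smt (verit) mult_pos_neg)
    moreover have "h x \<le> h (x + s)" using e(2)[of "x + s"] s by (simp add: dist_real_def)
    ultimately show False by simp
  qed
qed

text \<open>Riesz representation of the derivative: \<open>a\<close> is the Euclidean gradient field
  and \<open>A x\<close> the Hessian at \<open>x\<close> as an operator, the form in which both
  enter inner products below.\<close>

lemma C2_on_gradient:
  fixes f :: "'a::euclidean_space \<Rightarrow> real"
  assumes "C2_on U f"
  obtains a A where "\<forall>x\<in>U. (f has_derivative (\<lambda>v. a x \<bullet> v)) (at x)"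
    and "\<forall>x\<in>U. (a has_derivative A x) (at x)"
proof -
  obtain f' :: "'a \<Rightarrow> 'a \<Rightarrow>\<^sub>L real" and f'' :: "'a \<Rightarrow> 'a \<Rightarrow>\<^sub>L 'a \<Rightarrow>\<^sub>L real"
    where f': "\<And>x. x \<in> U \<Longrightarrow> (f has_derivative blinfun_apply (f' x)) (at x)"
      and f'': "\<And>x. x \<in> U \<Longrightarrow> (f' has_derivative blinfun_apply (f'' x)) (at x)"
    using assms unfolding C2_on_def by blast
  \<comment> \<open>\<open>R\<close> is the Riesz isomorphism in coordinates. Being bounded and
    linear, it carries the derivative of \<open>f'\<close> to that of the gradient.\<close>
  define R where "R L = (\<Sum>b\<in>Basis. blinfun_apply L b *\<^sub>R b)" for L :: "'a \<Rightarrow>\<^sub>L real"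
  have R: "R L \<bullet> v = blinfun_apply L v" for L v
  proof -
    have "blinfun_apply L v = blinfun_apply L (\<Sum>b\<in>Basis. (v \<bullet> b) *\<^sub>R b)"
      by (simp add: euclidean_representation)
    also have "\<dots> = R L \<bullet> v"
      by (simp add: R_def inner_sum_left blinfun.sum_right blinfun.scaleR_right inner_commute[of v] mult.commute)
    finally show ?thesis by simp
  qed
  have bl: "bounded_linear R" unfolding R_def
    by (intro bounded_linear_sum bounded_linear_compose[OF bounded_linear_scaleR_left]
        blinfun.bounded_linear_left)
  show ?thesis
  proof
    show "\<forall>x\<in>U. (f has_derivative (\<lambda>v. R (f' x) \<bullet> v)) (at x)"
      using f' by (simp add: R)
    show "\<forall>x\<in>U. ((\<lambda>x. R (f' x)) has_derivative (\<lambda>v. R (blinfun_apply (f'' x) v))) (at x)"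
      using bounded_linear.has_derivative[OF bl f''] by blast
  qed
qed

section \<open>Supporting functions near a boundary point\<close>

text \<open>The support condition speaks of the frontier, whereas the comparison needs all of
  \<open>\<Omega>\<close> near \<open>p\<close>. Close to \<open>p\<close> the function
  \<open>f\<close> decreases strictly along \<open>-\<nu>\<close>, and some nearby
  \<open>p - s *\<^sub>R \<nu>\<close> lies outside \<open>\<Omega>\<close>. A nearby point of
  \<open>\<Omega>\<close> with \<open>f < 0\<close> could be joined to it inside
  \<open>{f < 0}\<close>, and the path would cross the frontier, where
  \<open>f \<ge> 0\<close>.\<close>

lemma nonneg_near_supported_point:
  fixes f :: "'a::euclidean_space \<Rightarrow> real"
  assumes U: "open U" "p \<in> U"
    and f: "\<And>x. x \<in> U \<Longrightarrow> (f has_derivative (\<lambda>v. a x \<bullet> v)) (at x)"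
    and a: "continuous_on U a"
    and p: "f p = 0" "a p \<bullet> \<nu> > 0"
    and out: "inward_at \<Omega> p \<nu>"
    and fr: "\<And>x. x \<in> frontier \<Omega> \<inter> U \<Longrightarrow> f x \<ge> 0"
  shows "\<forall>\<^sub>F x in nhds p. x \<in> \<Omega> \<longrightarrow> f x \<ge> 0"
proof -
  have "\<forall>\<^sub>F x in at p. a x \<bullet> \<nu> > 0"
    using a U p(2) by (intro order_tendstoD(1)[OF tendsto_inner[OF _ tendsto_const]])
      (auto simp: continuous_on_eq_continuous_at isCont_def)
  then have "\<forall>\<^sub>F x in nhds p. x \<in> U \<and> a x \<bullet> \<nu> > 0"
    using U p(2) by (auto simp: eventually_at_filter eventually_nhds_in_open eventually_conj_iff elim: eventually_mono)
  then obtain e where e: "e > 0" "\<And>x. x \<in> ball p e \<Longrightarrow> x \<in> U \<and> a x \<bullet> \<nu> > 0"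
    unfolding eventually_nhds_metric by (auto simp: dist_commute)
  \<comment> \<open>The segment between the two points stays in the convex ball, where
    \<open>a\<close> pairs positively with \<open>\<nu>\<close>, so the mean value theorem applies
    along it.\<close>
  have dec: "f (x - t *\<^sub>R \<nu>) < f x"
    if "x \<in> ball p e" "x - t *\<^sub>R \<nu> \<in> ball p e" "t > 0" for x t
  proof -
    have "\<exists>z>0. z < t \<and> f (x - t *\<^sub>R \<nu>) - f (x - 0 *\<^sub>R \<nu>) = (t - 0) * (- (a (x - z *\<^sub>R \<nu>) \<bullet> \<nu>))"
    proof (rule MVT2[OF that(3)])
      fix s assume s: "0 \<le> s" "s \<le> t"
      have "x - s *\<^sub>R \<nu> = (1 - s / t) *\<^sub>R x + (s / t) *\<^sub>R (x - t *\<^sub>R \<nu>)"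
        using that(3) by (simp add: algebra_simps)
      then have "x - s *\<^sub>R \<nu> \<in> ball p e"
        using convexD[OF convex_ball that(1,2), of "1 - s/t" "s/t"] s that(3) by simp
      then have d: "(f has_derivative (\<lambda>v. a (x - s *\<^sub>R \<nu>) \<bullet> v)) (at (x - s *\<^sub>R \<nu>))" using f e by auto
      have "((\<lambda>s. x - s *\<^sub>R \<nu>) has_derivative (\<lambda>r. - (r *\<^sub>R \<nu>))) (at s)"
        by (auto intro!: derivative_eq_intros)
      from has_derivative_compose[OF this d]
      show "((\<lambda>s. f (x - s *\<^sub>R \<nu>)) has_real_derivative - (a (x - s *\<^sub>R \<nu>) \<bullet> \<nu>)) (at s)"
        unfolding has_field_derivative_def
        by (rule has_derivative_eq_rhs) (simp add: fun_eq_iff mult.commute)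
    qed
    then obtain z where z: "0 < z" "z < t" "f (x - t *\<^sub>R \<nu>) - f x = t * (- (a (x - z *\<^sub>R \<nu>) \<bullet> \<nu>))" by auto
    have "x - z *\<^sub>R \<nu> = (1 - z / t) *\<^sub>R x + (z / t) *\<^sub>R (x - t *\<^sub>R \<nu>)"
      using that(3) by (simp add: algebra_simps)
    then have "x - z *\<^sub>R \<nu> \<in> ball p e"
      using convexD[OF convex_ball that(1,2), of "1 - z/t" "z/t"] z that(3) by simp
    then have "a (x - z *\<^sub>R \<nu>) \<bullet> \<nu> > 0" using e by blast
    then have "t * (a (x - z *\<^sub>R \<nu>) \<bullet> \<nu>) > 0" using that(3) by simp
    then show ?thesis using z(3) by simp
  qed
  have "((\<lambda>s. p - s *\<^sub>R \<nu>) \<longlongrightarrow> p - 0 *\<^sub>R \<nu>) (at_right 0)" by (intro tendsto_intros)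
  then have "\<forall>\<^sub>F s in at_right 0. p - s *\<^sub>R \<nu> \<in> ball p e"
    by (rule topological_tendstoD) (use e in auto)
  then have "\<forall>\<^sub>F s in at_right 0. p - s *\<^sub>R \<nu> \<in> ball p e \<and> p - s *\<^sub>R \<nu> \<notin> \<Omega> \<and> s > 0"
    using out unfolding inward_at_def by (intro eventually_conj eventually_at_right_less)
  from eventually_happens[OF this] obtain s
    where s: "p - s *\<^sub>R \<nu> \<in> ball p e" "p - s *\<^sub>R \<nu> \<notin> \<Omega>" "s > 0" by (auto simp: trivial_limit_at_right_real)
  \<comment> \<open>The anchor point: outside \<open>\<Omega>\<close>, with \<open>f\<close>
    negative on a whole ball around it.\<close>
  let ?q = "p - s *\<^sub>R \<nu>"
  have fq: "f ?q < 0" using dec[of p s] s p e by auto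
  have "isCont f x" if "x \<in> ball p e" for x
    using has_derivative_continuous[OF f] e(2)[OF that] by simp
  then have "continuous_on (ball p e) f"
    by (simp add: continuous_at_imp_continuous_on)
  then have "open (ball p e \<inter> f -` {..<0})"
    by (rule continuous_open_preimage[OF _ open_ball open_lessThan])
  moreover have "ball p e \<inter> f -` {..<0} = {x \<in> ball p e. f x < 0}" by auto
  ultimately have "open {x \<in> ball p e. f x < 0}" by (rule subst[rotated])
  moreover have "?q \<in> {x \<in> ball p e. f x < 0}" using s(1) fq by blast
  ultimately obtain d where d: "d > 0" "ball ?q d \<subseteq> {x \<in> ball p e. f x < 0}"
    by (rule openE)
  have "x \<notin> \<Omega>" if x: "x \<in> ball p (min d e)" "f x < 0" for x
  proof
    assume xO: "x \<in> \<Omega>"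
    let ?y = "x - s *\<^sub>R \<nu>"
    have "dist ?q ?y = dist p x" by (simp add: dist_norm)
    then have y: "?y \<in> ball ?q d" using x by simp
    \<comment> \<open>A connected set from \<open>x\<close> to \<open>?q\<close>: translation along
      \<open>-\<nu>\<close> moves \<open>x\<close> into the ball around \<open>?q\<close>, because
      \<open>x\<close> is within \<open>d\<close> of \<open>p\<close>.\<close>
    let ?C = "closed_segment x ?y \<union> ball ?q d"
    have seg: "closed_segment x ?y \<subseteq> {x \<in> ball p e. f x < 0}"
    proof
      fix w assume w: "w \<in> closed_segment x ?y"
      then obtain u where u: "0 \<le> u" "u \<le> 1" "w = (1 - u) *\<^sub>R x + u *\<^sub>R ?y"
        unfolding in_segment by blast
      then have w': "w = x - (u * s) *\<^sub>R \<nu>" by (simp add: algebra_simps)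
      have "?y \<in> ball p e" using y d by blast
      then have wb: "w \<in> ball p e"
        using w x closed_segment_subset[OF _ _ convex_ball, of x p e ?y] by auto
      have "f w \<le> f x"
      proof (cases "u = 0")
        case False
        then show ?thesis using dec[of x "u * s"] w' wb x u s by auto
      qed (simp add: w')
      then show "w \<in> {x \<in> ball p e. f x < 0}" using wb x by simp
    qed
    have "connected ?C"
      by (rule connected_Un) (use y in auto)
    moreover have "?C \<inter> \<Omega> \<noteq> {}" using xO by auto
    moreover have "?C - \<Omega> \<noteq> {}" using s(2) centre_in_ball[of ?q d] d(1) by blast
    ultimately have "?C \<inter> frontier \<Omega> \<noteq> {}" by (rule connected_Int_frontier)
    moreover have "?C \<subseteq> {x \<in> ball p e. f x < 0}" using seg d by blast
    ultimately obtain w where "w \<in> frontier \<Omega>" "w \<in> ball p e" "f w < 0" by blast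
    then show False using fr[of w] e(2) by fastforce
  qed
  then show ?thesis unfolding eventually_nhds_metric
    by (intro exI[of _ "min d e"]) (use d e in \<open>force simp: dist_commute not_less\<close>)
qed

text \<open>The Hessian bound is the second order condition along the great circle through \<open>p\<close> in
  direction \<open>v\<close>.\<close>

lemma gradient_hessian_of_nonneg_on_ball:
  fixes f :: "'a::euclidean_space \<Rightarrow> real"
  assumes U: "open U" "p \<in> U" and p0: "p \<noteq> 0"
    and f: "\<And>x. x \<in> U \<Longrightarrow> (f has_derivative (\<lambda>v. a x \<bullet> v)) (at x)"
    and a: "(a has_derivative A) (at p)"
    and fp: "f p = 0"
    and nonneg: "\<forall>\<^sub>F x in nhds p. norm x \<le> norm p \<longrightarrow> f x \<ge> 0"
  obtains c where "c \<ge> 0" "a p = - c *\<^sub>R p" "\<And>v. p \<bullet> v = 0 \<Longrightarrow> A v \<bullet> v \<ge> - c * (norm v)\<^sup>2"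
proof -
  have curve: "a p \<bullet> v = 0 \<and> A v \<bullet> v - a p \<bullet> p \<ge> 0" if v: "p \<bullet> v = 0" "norm v = norm p" for v
  proof -
    \<comment> \<open>The great circle of radius \<open>norm p\<close>. Its acceleration
      \<open>- \<gamma> t\<close> produces the term \<open>- a p \<bullet> p\<close> in the second
      derivative of \<open>f\<close> along it.\<close>
    define \<gamma> where "\<gamma> t = cos t *\<^sub>R p + sin t *\<^sub>R v" for t
    define \<gamma>' where "\<gamma>' t = cos t *\<^sub>R v - sin t *\<^sub>R p" for t
    have \<gamma>: "(\<gamma> has_derivative (\<lambda>r. r *\<^sub>R \<gamma>' t)) (at t)" for t
      unfolding \<gamma>_def \<gamma>'_def by (auto intro!: derivative_eq_intros simp: fun_eq_iff algebra_simps)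
    have \<gamma>': "(\<gamma>' has_derivative (\<lambda>r. r *\<^sub>R - \<gamma> t)) (at t)" for t
      unfolding \<gamma>_def \<gamma>'_def by (auto intro!: derivative_eq_intros simp: fun_eq_iff algebra_simps)
    have \<gamma>0: "\<gamma> 0 = p" "\<gamma>' 0 = v" by (simp_all add: \<gamma>_def \<gamma>'_def)
    have "(norm (\<gamma> t))\<^sup>2 = (norm p)\<^sup>2" for t
    proof -
      have "(norm (\<gamma> t))\<^sup>2 = (cos t)\<^sup>2 * (norm p)\<^sup>2 + (sin t)\<^sup>2 * (norm v)\<^sup>2"
        using v(1) norm_add_Pythagorean[of "cos t *\<^sub>R p" "sin t *\<^sub>R v"]
        by (simp add: \<gamma>_def orthogonal_def power_mult_distrib)
      also have "\<dots> = ((cos t)\<^sup>2 + (sin t)\<^sup>2) * (norm p)\<^sup>2" unfolding v(2) by (rule distrib_right[symmetric])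
      finally show ?thesis by simp
    qed
    then have n: "norm (\<gamma> t) = norm p" for t by simp
    have lim: "filterlim \<gamma> (nhds p) (nhds 0)"
      using has_derivative_continuous[OF \<gamma>[of 0]] \<gamma>0 by (metis isCont_def tendsto_at_iff_tendsto_nhds)
    have ev: "\<forall>\<^sub>F t in nhds 0. \<gamma> t \<in> U"
      using eventually_compose_filterlim[OF eventually_nhds_in_open[OF U] lim] .
    have h: "\<forall>\<^sub>F t in nhds 0. ((\<lambda>t. f (\<gamma> t)) has_real_derivative a (\<gamma> t) \<bullet> \<gamma>' t) (at t)"
      using ev
    proof eventually_elim
      case (elim t)
      from has_derivative_compose[OF \<gamma>[of t] f[OF elim]]
      show ?case by (simp add: has_field_derivative_def mult.commute[of _ "_ \<bullet> _"])
    qed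
    have "(a has_derivative A) (at (\<gamma> 0))" using a \<gamma>0 by simp
    from has_derivative_inner[OF has_derivative_compose[OF \<gamma>[of 0] this] \<gamma>'[of 0]]
    have "((\<lambda>t. a (\<gamma> t) \<bullet> \<gamma>' t) has_derivative (\<lambda>r. a p \<bullet> (r *\<^sub>R - p) + A (r *\<^sub>R v) \<bullet> v)) (at 0)"
      by (simp add: \<gamma>0)
    moreover have "(\<lambda>r. a p \<bullet> (r *\<^sub>R - p) + A (r *\<^sub>R v) \<bullet> v) = (*) (A v \<bullet> v - a p \<bullet> p)"
      using linear_scale[OF has_derivative_linear[OF a]] by (simp add: fun_eq_iff algebra_simps)
    ultimately have h': "((\<lambda>t. a (\<gamma> t) \<bullet> \<gamma>' t) has_real_derivative (A v \<bullet> v - a p \<bullet> p)) (at 0)"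
      by (simp add: has_field_derivative_def)
    have min: "\<forall>\<^sub>F t in nhds 0. f (\<gamma> 0) \<le> f (\<gamma> t)"
      using eventually_compose_filterlim[OF nonneg lim] by (simp add: n \<gamma>0 fp)
    show ?thesis
      using second_derivative_nonneg_at_local_min[OF h h' min] by (simp add: \<gamma>0)
  qed
  \<comment> \<open>The coefficient of the orthogonal projection of \<open>- a p\<close> onto
    \<open>p\<close>.\<close>
  define c where "c = - (a p \<bullet> p) / (p \<bullet> p)"
  have pp: "p \<bullet> p > 0" using p0 by simp
  have orth: "a p \<bullet> v = 0" if "p \<bullet> v = 0" for v
  proof (cases "v = 0")
    case False
    then show ?thesis using curve[of "(norm p / norm v) *\<^sub>R v"] that p0 by simp
  qed simp
  \<comment> \<open>The component of \<open>a p\<close> orthogonal to \<open>p\<close>; it vanishes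
    since \<open>a p\<close> annihilates every direction tangent to the sphere.\<close>
  define u where "u = a p + c *\<^sub>R p"
  have pu: "p \<bullet> u = 0" using pp by (simp add: u_def c_def inner_add_right inner_diff_right inner_commute)
  have "u \<bullet> u = a p \<bullet> u + c * (p \<bullet> u)" by (simp add: u_def inner_add_left)
  then have "u = 0" using pu orth by simp
  then have ap: "a p = - c *\<^sub>R p" by (simp add: u_def eq_neg_iff_add_eq_0)
  have "c \<ge> 0"
  proof (rule ccontr)
    assume c: "\<not> c \<ge> 0"
    \<comment> \<open>Moving from \<open>p\<close> towards the origin stays in the ball, and
      \<open>f\<close> changes at the rate \<open>c * (p \<bullet> p)\<close>, which must not be
      negative.\<close>
    have g: "((\<lambda>t. p - t *\<^sub>R p) has_derivative (\<lambda>r. - (r *\<^sub>R p))) (at 0)"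
      by (auto intro!: derivative_eq_intros)
    have "((\<lambda>t. f (p - t *\<^sub>R p)) has_real_derivative c * (p \<bullet> p)) (at 0)"
      using has_derivative_compose[OF g, of f "\<lambda>v. a p \<bullet> v"] f[OF U(2)]
      by (simp add: has_field_derivative_def ap mult.commute[of _ "c * _"] mult.left_commute[of _ c])
    moreover have "c * (p \<bullet> p) < 0" using c pp by (simp add: mult_neg_pos)
    ultimately obtain d where d: "d > 0" "\<And>s. 0 < s \<Longrightarrow> s < d \<Longrightarrow> f (p - s *\<^sub>R p) < 0"
      using has_real_derivative_neg_dec_right[of "\<lambda>t. f (p - t *\<^sub>R p)" "c * (p \<bullet> p)" 0 UNIV] fp by auto
    have "((\<lambda>t. p - t *\<^sub>R p) \<longlongrightarrow> p - 0 *\<^sub>R p) (at_right 0)" by (intro tendsto_intros)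
    then have "filterlim (\<lambda>t. p - t *\<^sub>R p) (nhds p) (at_right 0)" by simp
    from eventually_compose_filterlim[OF nonneg this]
    have "\<forall>\<^sub>F t in at_right 0. norm (p - t *\<^sub>R p) \<le> norm p \<longrightarrow> f (p - t *\<^sub>R p) \<ge> 0" .
    moreover have "\<forall>\<^sub>F t in at_right (0::real). t \<in> {0<..<min d 1}"
      by (rule eventually_at_right_real) (use d in auto)
    ultimately have "\<forall>\<^sub>F t in at_right (0::real). False"
    proof eventually_elim
      case (elim t)
      have "p - t *\<^sub>R p = (1 - t) *\<^sub>R p" by (simp add: algebra_simps)
      then have "norm (p - t *\<^sub>R p) = (1 - t) * norm p" using elim(2) by simp
      also have "\<dots> \<le> 1 * norm p" using elim(2) by (intro mult_right_mono) auto
      finally show ?case using elim d(2)[of t] by auto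
    qed
    then show False by (simp add: trivial_limit_at_right_real eventually_False)
  qed
  moreover have "A v \<bullet> v \<ge> - c * (norm v)\<^sup>2" if v: "p \<bullet> v = 0" for v
  proof (cases "v = 0")
    case False
    \<comment> \<open>Rescales \<open>v\<close> to the length \<open>norm p\<close> that the great
      circle requires; the factor \<open>r\<^sup>2\<close> cancels afterwards.\<close>
    define r where "r = norm p / norm v"
    have r: "r > 0" using False p0 by (simp add: r_def)
    have "A (r *\<^sub>R v) \<bullet> (r *\<^sub>R v) - a p \<bullet> p \<ge> 0"
      using curve[of "r *\<^sub>R v"] v False by (simp add: r_def)
    moreover have "A (r *\<^sub>R v) = r *\<^sub>R A v"
      using linear_scale[OF has_derivative_linear[OF a]] by simp
    moreover have "a p \<bullet> p = - c * (r\<^sup>2 * (norm v)\<^sup>2)"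
      using False by (simp add: ap r_def power_divide power2_norm_eq_inner)
    ultimately have "r\<^sup>2 * (A v \<bullet> v + c * (norm v)\<^sup>2) \<ge> 0"
      by (simp add: power2_eq_square algebra_simps)
    then show ?thesis using r by (simp add: zero_le_mult_iff)
  qed (simp add: linear_0[OF has_derivative_linear[OF a]])
  ultimately show ?thesis using ap that by blast
qed

section \<open>Normal curvatures in the ball model\<close>

lemma riemann_gradient_CH:
  fixes z :: "complex ^ 'n"
  assumes k: "k > 0" and z: "z \<in> CH_space"
    and f: "(f has_derivative (\<lambda>v. a \<bullet> v)) (at z)"
  shows "riemann_gradient (CH_metric k) f z = (k\<^sup>2 * (1 - (norm z)\<^sup>2)) *\<^sub>R (a - herm a z *s z)" (is "_ = ?W")
    and "CH_metric k z (riemann_gradient (CH_metric k) f z) v = a \<bullet> v"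
proof -
  define s where "s = 1 - (norm z)\<^sup>2"
  have s: "s > 0" using z by (simp add: s_def CH_space_def abs_square_less_1)
  have eq: "CH_metric k z ?W v = a \<bullet> v" for v
  proof -
    have "herm z z = of_real (1 - s)" by (simp add: s_def herm_self)
    then show ?thesis using k s
      unfolding CH_metric_def inner_eq_Re_herm herm_scaleR_left herm_diff_left herm_smult_left s_def[symmetric]
      by (simp add: divide_simps power2_eq_square) (simp add: algebra_simps)
  qed
  have fd: "frechet_derivative f (at z) v = a \<bullet> v" for v
    using fun_cong[OF frechet_derivative_at[OF f], of v] by simp
  show W: "riemann_gradient (CH_metric k) f z = ?W"
    unfolding riemann_gradient_def fd
  proof (rule the_equality)
    fix w assume "\<forall>v. CH_metric k z w v = a \<bullet> v"
    then show "w = ?W" using eq by (intro CH_metric_eqI[OF k z]) simp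
  qed (use eq in blast)
  show "CH_metric k z (riemann_gradient (CH_metric k) f z) v = a \<bullet> v" unfolding W by (rule eq)
qed

text \<open>The rank-one term of the metric vanishes on \<open>v\<close>, which leaves a multiple of
  the Euclidean inner product.\<close>

lemma CH_metric_at_orthogonal:
  assumes "herm p v = 0"
  shows "CH_metric k p u v = u \<bullet> v / (k\<^sup>2 * (1 - (norm p)\<^sup>2))"
  using assms by (simp add: CH_metric_def inner_eq_Re_herm mult.commute)

text \<open>For a radial gradient at \<open>p\<close> and \<open>v\<close> complex orthogonal to
  \<open>p\<close>, the derivative of the normalizing factor contributes only a multiple of
  \<open>p\<close>, and the Christoffel term cancels the part coming from the derivative of the
  metric coefficients. Only the Euclidean Hessian remains.\<close>

lemma normal_curvature_CH:
  fixes p :: "complex ^ 'n"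
  assumes k: "k > 0" and p: "p \<in> CH_space" "p \<noteq> 0" and U: "open U" "p \<in> U" "U \<subseteq> CH_space"
    and f: "\<And>x. x \<in> U \<Longrightarrow> (f has_derivative (\<lambda>v. a x \<bullet> v)) (at x)"
    and a: "(a has_derivative A) (at p)"
    and c: "c > 0" "a p = - c *\<^sub>R p"
    and v: "herm p v = 0"
  shows "CH_metric k p (unit_gradient (CH_metric k) f p) v = 0"
    and "CH_metric k p (- cov_deriv (CH_metric k) (unit_gradient (CH_metric k) f) p v) v
       = - (A v \<bullet> v) / (c * k * (1 - (norm p)\<^sup>2) * norm p)"
proof -
  let ?g = "CH_metric k"
  define s where "s = 1 - (norm p)\<^sup>2"
  have s: "s > 0" using p by (simp add: s_def CH_space_def abs_square_less_1)
  \<comment> \<open>The closed form of the Riemannian gradient on \<open>U\<close>; \<open>q\<close>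
    is its squared length, since pairing with it in the metric is the Euclidean pairing with
    \<open>a\<close>.\<close>
  define W where "W x = (k\<^sup>2 * (1 - (norm x)\<^sup>2)) *\<^sub>R (a x - herm (a x) x *s x)" for x
  define q where "q x = a x \<bullet> W x" for x
  have X: "unit_gradient ?g f x = (1 / sqrt (q x)) *\<^sub>R W x" if "x \<in> U" for x
    using riemann_gradient_CH[OF k _ f[OF that]] U(3) that
    by (auto simp: unit_gradient_def Let_def W_def q_def)
  have hp: "herm p p = of_real ((norm p)\<^sup>2)" by (rule herm_self)
  have hcp: "herm (a p) p = of_real (- c * (norm p)\<^sup>2)"
    unfolding c(2) herm_scaleR_left hp by simp
  have Wp: "W p = (- c * k\<^sup>2 * s\<^sup>2) *\<^sub>R p"
    unfolding W_def hcp
    by (simp add: c(2) vec_eq_iff complex_eq_iff s_def power2_eq_square algebra_simps)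
  have qp: "q p = (c * k * s * norm p)\<^sup>2"
    by (simp add: q_def Wp c(2) power2_norm_eq_inner[symmetric] power2_eq_square)
  have pos: "c * k * s * norm p > 0" using c(1) k s p(2) by simp
  have sq: "sqrt (q p) = c * k * s * norm p"
    using pos unfolding qp real_sqrt_abs by (rule abs_of_pos)
  have nz: "c \<noteq> 0" "k \<noteq> 0" "s \<noteq> 0" "norm p \<noteq> 0" using c(1) k s p(2) by auto
  have pv: "p \<bullet> v = 0" using v by (simp add: inner_eq_Re_herm)
  have vp: "herm v p = 0" using v herm_commute[of v p] by simp
  have "\<exists>B. ((\<lambda>x. herm (a x) x *s x) has_derivative B) (at p) \<and>
      B v \<bullet> v = - c * (norm p)\<^sup>2 * (v \<bullet> v)"
  proof -
    have hd: "((\<lambda>x. herm (a x) x) has_derivative (\<lambda>u. herm (a p) u + herm (A u) p)) (at p)"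
      by (rule bounded_bilinear.FDERIV[OF bounded_bilinear_herm a has_derivative_ident])
    have bl: "bounded_bilinear (\<lambda>(c::complex) (x::complex^'n). c *s x)"
      by (rule bilinear_conv_bounded_bilinear[THEN iffD1])
         (auto simp: bilinear_def vec_eq_iff algebra_simps scaleR_conv_of_real[where 'a = complex]
           intro!: linearI)
    \<comment> \<open>In the product rule the terms that differentiate the coefficient are complex
      multiples of \<open>p\<close>, hence orthogonal to \<open>v\<close>; only
      \<open>herm (a p) p *s v\<close> survives.\<close>
    have *: "(u *s p) \<bullet> v = 0" for u
      using v by (simp add: inner_eq_Re_herm herm_smult_left)
    show ?thesis
      by (rule exI, rule conjI, rule bounded_bilinear.FDERIV[OF bl hd has_derivative_ident])
         (simp add: inner_add_left inner_diff_left * hcp, simp add: inner_eq_Re_herm herm_smult_left)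
  qed
  then obtain B where B: "((\<lambda>x. herm (a x) x *s x) has_derivative B) (at p)"
    "B v \<bullet> v = - c * (norm p)\<^sup>2 * (v \<bullet> v)" by blast
  have n: "((\<lambda>y::complex^'n. k\<^sup>2 * (1 - (norm y)\<^sup>2)) has_derivative (\<lambda>u. - 2 * k\<^sup>2 * (p \<bullet> u))) (at p)"
    unfolding power2_norm_eq_inner
    by (auto intro!: derivative_eq_intros simp: inner_commute)
  define D where "D u = (k\<^sup>2 * s) *\<^sub>R (A u - B u) + (- 2 * k\<^sup>2 * (p \<bullet> u)) *\<^sub>R (a p - herm (a p) p *s p)" for u
  have W: "(W has_derivative D) (at p)"
    unfolding W_def D_def s_def
    by (rule has_derivative_scaleR[OF n has_derivative_diff[OF a B(1)]])
  have qd: "(q has_derivative (\<lambda>u. a p \<bullet> D u + A u \<bullet> W p)) (at p)"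
    unfolding q_def by (rule has_derivative_inner[OF a W])
  have "q p > 0" unfolding qp using pos by (rule zero_less_power)
  from DERIV_real_sqrt[OF this]
  have "(sqrt has_derivative (*) (inverse (sqrt (q p)) / 2)) (at (q p))"
    by (simp add: has_field_derivative_def)
  \<comment> \<open>The value of \<open>\<phi>'\<close> can stay unspecified: it multiplies
    \<open>W p\<close>, which is parallel to \<open>p\<close> and so orthogonal to
    \<open>v\<close>.\<close>
  from has_derivative_divide[OF has_derivative_const has_derivative_compose[OF qd this], of 1]
  obtain \<phi>' where \<phi>: "((\<lambda>x. 1 / sqrt (q x)) has_derivative \<phi>') (at p)"
    using \<open>q p > 0\<close> by fastforce
  have "(unit_gradient ?g f has_derivative (\<lambda>u. (1 / sqrt (q p)) *\<^sub>R D u + \<phi>' u *\<^sub>R W p)) (at p)"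
    by (rule has_derivative_transform_within_open[OF has_derivative_scaleR[OF \<phi> W] U(1,2)])
       (simp add: X)
  from fun_cong[OF frechet_derivative_at[OF this], of v]
  have fd: "frechet_derivative (unit_gradient ?g f) (at p) v = (1 / sqrt (q p)) *\<^sub>R D v + \<phi>' v *\<^sub>R W p"
    by simp
  have Dv: "D v \<bullet> v = k\<^sup>2 * s * (A v \<bullet> v + c * (norm p)\<^sup>2 * (v \<bullet> v))"
    by (simp add: D_def pv B(2) inner_add_left inner_diff_left)
  have Xp: "unit_gradient ?g f p = (- (k * s / norm p)) *\<^sub>R p"
    unfolding X[OF U(2)] sq Wp using nz by (simp add: power2_eq_square)
  have "herm (unit_gradient ?g f p) p = of_real (- (k * s / norm p) * (norm p)\<^sup>2)"
    unfolding Xp herm_scaleR_left hp by simp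
  also have "- (k * s / norm p) * (norm p)\<^sup>2 = - k * s * norm p"
    using p by (simp add: power2_eq_square)
  finally have hX: "herm (unit_gradient ?g f p) p = of_real (- k * s * norm p)" .
  \<comment> \<open>Of the two symmetric terms one carries the factor
    \<open>herm v p = 0\<close>.\<close>
  have "christoffel ?g p v (unit_gradient ?g f p) = (- k * norm p) *\<^sub>R v"
    unfolding christoffel_CH[OF k p(1)] vp hX s_def[symmetric]
    using s by (simp add: vec_eq_iff complex_eq_iff)
  then have "cov_deriv ?g (unit_gradient ?g f) p v \<bullet> v
    = k\<^sup>2 * s * (A v \<bullet> v + c * (norm p)\<^sup>2 * (v \<bullet> v)) / (c * k * s * norm p) - k * norm p * (v \<bullet> v)"
    unfolding cov_deriv_def fd inner_add_left inner_scaleR_left Dv sq Wp pv by simp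
  \<comment> \<open>The two multiples of \<open>k * norm p * (v \<bullet> v)\<close> cancel.\<close>
  also have "\<dots> = k * (A v \<bullet> v) / (c * norm p)"
    using nz by (simp add: divide_simps) (simp add: algebra_simps power2_eq_square)
  finally have cov: "cov_deriv ?g (unit_gradient ?g f) p v \<bullet> v = k * (A v \<bullet> v) / (c * norm p)" .
  have "?g p (- cov_deriv ?g (unit_gradient ?g f) p v) v = - (k * (A v \<bullet> v) / (c * norm p)) / (k\<^sup>2 * s)"
    by (simp only: CH_metric_at_orthogonal[OF v] inner_minus_left cov s_def)
  also have "\<dots> = - (A v \<bullet> v) / (c * k * s * norm p)"
    using nz by (simp add: divide_simps power2_eq_square)
  finally show "?g p (- cov_deriv ?g (unit_gradient ?g f) p v) v
       = - (A v \<bullet> v) / (c * k * (1 - (norm p)\<^sup>2) * norm p)"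
    by (simp only: s_def)
  show "?g p (unit_gradient ?g f p) v = 0"
    by (simp only: CH_metric_at_orthogonal[OF v] Xp inner_scaleR_left pv mult_zero_right div_0)
qed

section \<open>The bound for one domain and for an exhausting family\<close>

text \<open>Complex dimension at least 2 enters here. The remaining tangent direction
  \<open>\<i> *s p\<close> of a geodesic sphere has the larger normal curvature
  \<open>2k coth(2kr)\<close>, which tends to \<open>2k\<close>.\<close>

lemma exists_herm_orthogonal:
  fixes p :: "complex ^ 'n"
  assumes "CARD('n) \<ge> 2"
  obtains v where "v \<noteq> 0" "herm p v = 0"
proof -
  obtain i j :: 'n where ij: "i \<noteq> j"
    using assms by (metis card_le_Suc0_iff_eq finite not_less_eq_eq numeral_2_eq_2)
  show ?thesis
  proof (cases "p $ i = 0")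
    case True
    have "herm p (axis i 1) = (\<Sum>l\<in>UNIV. if l = i then p $ i else 0)"
      unfolding herm_def axis_def by (rule sum.cong) auto
    then show ?thesis using True by (intro that[of "axis i 1"]) simp_all
  next
    case False
    let ?v = "\<chi> l. if l = i then - cnj (p $ j) else if l = j then cnj (p $ i) else 0"
    have "herm p ?v = (\<Sum>l\<in>UNIV. (if l = i then - (p $ i * p $ j) else 0) + (if l = j then p $ i * p $ j else 0))"
      unfolding herm_def by (rule sum.cong) (use ij in auto)
    also have "\<dots> = 0" by (simp add: sum.distrib)
    finally have "herm p ?v = 0" .
    moreover have "?v $ j \<noteq> 0" using ij False by simp
    then have "?v \<noteq> 0" by (metis zero_index)
    ultimately show ?thesis by (intro that)
  qed
qed

text \<open>The comparison argument for a single domain; \<open>\<rho>\<close> is the Euclidean norm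
  of a frontier point closest to the origin.\<close>

lemma lambda_convex_domain_bound:
  fixes \<Omega> :: "(complex ^ 'n) set"
  assumes n: "CARD('n) \<ge> 2" and k: "k > 0"
    and dom: "compact_domain CH_space \<Omega>"
    and conv: "lambda_convex_domain (CH_metric k) CH_space lam \<Omega>"
    and r: "r > 0" "cball 0 r \<subseteq> \<Omega>"
  obtains \<rho> where "r \<le> \<rho>" "lam * \<rho> \<le> k"
proof -
  let ?g = "CH_metric k"
  have cpt: "compact \<Omega>" and "\<Omega> \<noteq> {}" using dom by (auto simp: compact_domain_def)
  moreover have "\<Omega> \<noteq> UNIV" using cpt by (metis not_bounded_UNIV compact_imp_bounded)
  ultimately have "frontier \<Omega> \<noteq> {}" by (metis frontier_not_empty)
  moreover have "compact (frontier \<Omega>)" using cpt by (rule compact_frontier)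
  ultimately obtain p where p: "p \<in> frontier \<Omega>" "\<And>x. x \<in> frontier \<Omega> \<Longrightarrow> norm p \<le> norm x"
    using continuous_attains_inf[of "frontier \<Omega>" norm] continuous_on_norm_id by blast
  have "ball 0 r \<subseteq> interior \<Omega>"
    using r(2) by (meson ball_subset_cball interior_maximal open_ball order_trans)
  then have rp: "r \<le> norm p" using p(1) by (force simp: frontier_def)
  then have p0: "p \<noteq> 0" using r by auto
  \<comment> \<open>A connected set that meets \<open>\<Omega>\<close> but not its frontier lies in
    \<open>\<Omega>\<close>.\<close>
  have "ball 0 (norm p) \<inter> frontier \<Omega> = {}" using p(2) by force
  moreover have "0 \<in> ball 0 (norm p) \<inter> \<Omega>" using p0 r by auto
  ultimately have "ball 0 (norm p) \<subseteq> \<Omega>"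
    using connected_Int_frontier[OF connected_ball, of 0 "norm p" \<Omega>] by blast
  \<comment> \<open>The closed ball is needed because the great circles of the Hessian comparison
    lie on its boundary sphere.\<close>
  then have "closure (ball 0 (norm p)) \<subseteq> \<Omega>"
    using cpt by (simp add: closure_minimal compact_imp_closed)
  then have ball: "x \<in> \<Omega>" if "norm x \<le> norm p" for x using that p0 by (auto simp: subset_iff)
  obtain S N where S: "p \<in> S" "regular_lambda_convex ?g CH_space lam S N" "inward_at \<Omega> p (N p)"
    "locally_on_convex_side ?g CH_space S N (frontier \<Omega>) p" and pH: "p \<in> CH_space"
    using conv p(1) unfolding lambda_convex_domain_def lambda_convex_hypersurface_def by blast
  then obtain U f where U: "p \<in> U" and df: "defining_function ?g CH_space S N U f"
    and fr: "\<And>x. x \<in> frontier \<Omega> \<inter> U \<Longrightarrow> f x \<ge> 0"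
    unfolding locally_on_convex_side_def by blast
  have oU: "open U" "U \<subseteq> CH_space" and C2: "C2_on U f" and fp: "f p = 0"
    and grad: "frechet_derivative f (at p) \<noteq> (\<lambda>v. 0)" and Np: "N p = unit_gradient ?g f p"
    using df U S(1) unfolding defining_function_def by auto
  obtain a A where "\<forall>x\<in>U. (f has_derivative (\<lambda>v. a x \<bullet> v)) (at x)"
    and "\<forall>x\<in>U. (a has_derivative A x) (at x)"
    using C2_on_gradient[OF C2] .
  then have f: "(f has_derivative (\<lambda>v. a x \<bullet> v)) (at x)" and A: "(a has_derivative A x) (at x)"
    if "x \<in> U" for x using that by blast+
  have ap0: "a p \<noteq> 0" using grad frechet_derivative_at[OF f[OF U]] by auto
  define W where "W = riemann_gradient ?g f p"
  have W: "?g p W v = a p \<bullet> v" for v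
    unfolding W_def by (rule riemann_gradient_CH(2)[OF k pH f[OF U]])
  have "W \<noteq> 0" using W[of "a p"] ap0 by (auto simp: CH_metric_def herm_def)
  then have gW: "?g p W W > 0" using CH_metric_pos[OF k pH] by blast
  \<comment> \<open>Euclidean pairing with \<open>a p\<close> is metric pairing with
    \<open>W\<close>, and \<open>N p\<close> is a positive multiple of \<open>W\<close>.\<close>
  then have "a p \<bullet> N p > 0" using W[of W] by (simp add: Np unit_gradient_def Let_def W_def[symmetric])
  moreover have "continuous_on U a"
    using A by (auto intro!: continuous_at_imp_continuous_on has_derivative_continuous)
  ultimately have "\<forall>\<^sub>F x in nhds p. x \<in> \<Omega> \<longrightarrow> f x \<ge> 0"
    using nonneg_near_supported_point[OF oU(1) U f _ fp _ S(3) fr] by blast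
  then have "\<forall>\<^sub>F x in nhds p. norm x \<le> norm p \<longrightarrow> f x \<ge> 0"
    by (rule eventually_mono) (use ball in blast)
  from gradient_hessian_of_nonneg_on_ball[OF oU(1) U p0 f A[OF U] fp this]
  obtain c where c: "c \<ge> 0" "a p = - c *\<^sub>R p"
    "\<And>v. p \<bullet> v = 0 \<Longrightarrow> A p v \<bullet> v \<ge> - c * (norm v)\<^sup>2" by blast
  have c0: "c > 0" using c(1,2) ap0 by (cases "c = 0") auto
  obtain u where u: "u \<noteq> 0" "herm p u = 0" using exists_herm_orthogonal[OF n] .
  define s where "s = 1 - (norm p)\<^sup>2"
  have s: "s > 0" using pH by (simp add: s_def CH_space_def abs_square_less_1)
  \<comment> \<open>Scaled to unit length in the metric, which is the Euclidean one divided by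
    \<open>k\<^sup>2 * s\<close> in this direction.\<close>
  define v where "v = (k * sqrt s / norm u) *\<^sub>R u"
  have v: "herm p v = 0" using u by (simp add: v_def herm_scaleR_right)
  have nv: "(norm v)\<^sup>2 = k\<^sup>2 * s" using u k s by (simp add: v_def power_mult_distrib)
  have gv: "?g p v v = 1"
    unfolding CH_metric_at_orthogonal[OF v] power2_norm_eq_inner[symmetric] nv
    using k s by (simp add: s_def)
  note nc = normal_curvature_CH[OF k pH p0 oU(1) U oU(2) f A[OF U] c0 c(2) v]
  have "lam \<le> ?g p (- cov_deriv ?g (unit_gradient ?g f) p v) v"
    using S(1,2) U df gv nc(1) unfolding regular_lambda_convex_def Np[symmetric] by blast
  also have "\<dots> = - (A p v \<bullet> v) / (c * k * s * norm p)" using nc(2) by (simp add: s_def)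
  also have "\<dots> \<le> c * (k\<^sup>2 * s) / (c * k * s * norm p)"
    using c(3)[of v] v nv c0 k s p0 by (intro divide_right_mono) (auto simp: inner_eq_Re_herm)
  also have "\<dots> = k / norm p" using c0 k s by (simp add: power2_eq_square)
  finally have "lam * norm p \<le> k" using p0 by (simp add: pos_le_divide_eq)
  then show ?thesis using rp that by blast
qed

theorem theorem1p1:
  fixes k lam :: real and \<Omega> :: "real \<Rightarrow> (complex ^ 'n) set"
  assumes "CARD('n) \<ge> 2" and "k > 0" and "lam \<ge> 0"
    and "\<And>t. t > 0 \<Longrightarrow> compact_domain CH_space (\<Omega> t)"
    and "\<And>t. t > 0 \<Longrightarrow> lambda_convex_domain (CH_metric k) CH_space lam (\<Omega> t)"
    and "expands_over CH_space \<Omega>"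
  shows "lam \<le> k"
proof (rule field_le_mult_one_interval)
  \<comment> \<open>It suffices to bound \<open>r * lam\<close> for every \<open>r\<close> below 1,
    since the closed balls of such radii are compact subsets of the space.\<close>
  fix r :: real assume r: "0 < r" "r < 1"
  have "cball 0 r \<subseteq> (CH_space :: (complex ^ 'n) set)" using r by (auto simp: CH_space_def)
  then have "\<forall>\<^sub>F t in at_top. cball 0 r \<subseteq> \<Omega> t"
    using assms(6) by (simp add: expands_over_def)
  from eventually_happens[OF eventually_conj[OF this eventually_gt_at_top[of 0]]]
  obtain t where t: "t > 0" "cball 0 r \<subseteq> \<Omega> t" by auto
  obtain \<rho> where \<rho>: "r \<le> \<rho>" "lam * \<rho> \<le> k"
    using lambda_convex_domain_bound[OF assms(1,2) assms(4,5)[OF t(1)] r(1) t(2)] .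
  \<comment> \<open>Nonnegativity of \<open>lam\<close> allows \<open>\<rho>\<close> to be replaced
    by the smaller \<open>r\<close>.\<close>
  have "r * lam \<le> lam * \<rho>" using mult_left_mono[OF \<rho>(1) assms(3)] by (simp add: mult.commute)
  then show "r * lam \<le> k" using \<rho>(2) by simp
qed

end
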